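(* Consider a private information retrieval query scheme with $M\ge 2$ messages and $S\ge 2$ servers, whose queries are generated as $Q_{1:S}^{(m)}=\psi(m,F)$ with $\psi$ a bijection onto the query realization set $\mathcal{Q}$, the index $\theta$ being uniform on $[1:M]$ and $Q_{1:S}^{(\theta)}$ being uniform on $\mathcal{Q}$ (see context). Assume $H(Q_{1:S}^{(\theta)}\mid\theta=m)=H(Q_{1:S}^{(\theta)}\mid\theta=m')$ for all $m,m'\in[1:M]$. Let $\mathcal{T}\subset[1:S]$ be the index set of $T$ colluding servers ($|\mathcal{T}|=T$) and let $q_{\mathcal{T}}$ be a possible value of the queries to the servers in $\mathcal{T}$. Then $$\Pr\{Q_{\mathcal{T}}^{(\theta)}=q_{\mathcal{T}}\mid\theta=m\}=\Pr\{Q_{\mathcal{T}}^{(\theta)}=q_{\mathcal{T}}\mid\theta=m'\}\quad\text{for all } m,m'\in[1:M]$$ if and only if $$\bigl|\{Q_{1:S}^{(\theta)}\mid Q_{\mathcal{T}}^{(\theta)}=q_{\mathcal{T}}\}\bigr| = M\,\bigl|\{Q_{1:S}^{(m)}\mid Q_{\mathcal{T}}^{(m)}=q_{\mathcal{T}}\}\bigr|\quad\text{for all } m\in[1:M].$$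
   Context: Notation: $[1:Z]=\{1,\dots,Z\}$. $H$ denotes Shannon entropy. A user wants to retrieve the message with index $\theta\in[1:M]$ from $S$ servers; $\theta$ is a random variable, uniformly distributed on $[1:M]$. When $\theta=m$, the user sends the query $Q_j^{(m)}$ to server $j$ for each $j\in[1:S]$; $Q_{1:S}^{(m)}=(Q_1^{(m)},\dots,Q_S^{(m)})$, and for $\mathcal{T}\subset[1:S]$, $Q_{\mathcal{T}}^{(m)}=(Q_j^{(m)})_{j\in\mathcal{T}}$. Query generation: $F$ is a random key uniformly distributed on a finite set $\mathcal{F}$, and $Q_{1:S}^{(m)}=\psi(m,F)$, where $\psi:[1:M]\times\mathcal{F}\to\mathcal{Q}$ is a bijection onto the set $\mathcal{Q}$ of all query realizations $q_{1:S}=(q_1,\dots,q_S)$. The tuple $Q_{1:S}^{(\theta)}=\psi(\theta,F)$ is uniformly distributed on $\mathcal{Q}$ (equivalently, $\theta$ and $F$ are independent and uniform). $\{Q_{1:S}^{(\theta)}\mid Q_{\mathcal{T}}^{(\theta)}=q_{\mathcal{T}}\}$ denotes the set of all realizations in $\mathcal{Q}$ (over all indices and keys) whose components indexed by $\mathcal{T}$ equal $q_{\mathcal{T}}$, and $\{Q_{1:S}^{(m)}\mid Q_{\mathcal{T}}^{(m)}=q_{\mathcal{T}}\}$ denotes the set of all realizations of the form $\psi(m,f)$, $f\in\mathcal{F}$, whose components indexed by $\mathcal{T}$ equal $q_{\mathcal{T}}$. *)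

theory Defs
  imports "HOL-Probability.Probability"
begin

text \<open>Intended for finite nonempty \<open>A\<close>. Values are required to lie in \<open>A\<close> on all of
  \<open>space P\<close>, not just almost surely.\<close>

definition uniform_rv :: "'w measure \<Rightarrow> ('w \<Rightarrow> 'a) \<Rightarrow> 'a set \<Rightarrow> bool" where
  "uniform_rv P X A \<longleftrightarrow>
     X \<in> measurable P (count_space A) \<and> distr P (count_space A) X = uniform_count_measure A"

text \<open>The tuple \<open>Q\<^bsub>1:S\<^esub>\<^bsup>(\<theta>)\<^esup>\<close> sent by the user. A query tuple \<open>(q\<^sub>1, \<dots>, q\<^sub>S)\<close> is
  a function on \<open>{1..S}\<close> in the sense of \<open>extensional\<close>, and the subtuple with components in \<open>\<T>\<close>
  is \<open>restrict q \<T>\<close>.\<close>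

definition user_query ::
    "(nat \<times> 'f \<Rightarrow> nat \<Rightarrow> 'q) \<Rightarrow> ('w \<Rightarrow> nat) \<Rightarrow> ('w \<Rightarrow> 'f) \<Rightarrow> 'w \<Rightarrow> (nat \<Rightarrow> 'q)" where
  "user_query \<psi> \<theta> F = (\<lambda>\<omega>. \<psi> (\<theta> \<omega>, F \<omega>))"

text \<open>Uniformity of the query on \<open>\<Q>\<close> together with bijectivity of \<open>\<psi>\<close> makes \<open>(\<theta>, F)\<close>
  uniform on \<open>{1..M} \<times> \<F>\<close>, so independence of \<open>\<theta>\<close> and \<open>F\<close> is implied. The type \<open>'q\<close>
  accommodates the query alphabets of all servers.\<close>

locale pir_query_scheme = prob_space P for P :: "'w measure" +
  fixes M S :: nat
    and \<F> :: "'f set"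
    and \<Q> :: "(nat \<Rightarrow> 'q) set"
    and \<psi> :: "nat \<times> 'f \<Rightarrow> nat \<Rightarrow> 'q"
    and \<theta> :: "'w \<Rightarrow> nat"
    and F :: "'w \<Rightarrow> 'f"
  assumes M_ge_2: "2 \<le> M"
    and S_ge_2: "2 \<le> S"
    and finite_keys: "finite \<F>"
    and queries_extensional: "\<Q> \<subseteq> extensional {1..S}"
    and bij_psi: "bij_betw \<psi> ({1..M} \<times> \<F>) \<Q>"
    and index_uniform: "uniform_rv P \<theta> {1..M}"
    and key_uniform: "uniform_rv P F \<F>"
    and query_uniform: "uniform_rv P (user_query \<psi> \<theta> F) \<Q>"

text \<open>\<open>H(X | Y = y)\<close> for an \<open>A\<close>-valued \<open>X\<close>: the entropy, to base \<open>b\<close>, of \<open>X\<close> under \<open>P\<close>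
  conditioned on the event \<open>Y = y\<close>, which must have positive probability. (The library's
  conditional entropy is the average of this over \<open>y\<close>.)\<close>

definition entropy_given ::
    "real \<Rightarrow> 'w measure \<Rightarrow> 'a set \<Rightarrow> ('w \<Rightarrow> 'a) \<Rightarrow> ('w \<Rightarrow> 'b) \<Rightarrow> 'b \<Rightarrow> real" where
  "entropy_given b P A X Y y =
     prob_space.entropy (uniform_measure P {\<omega> \<in> space P. Y \<omega> = y}) b (count_space A) X"

definition matching_queries ::
    "(nat \<Rightarrow> 'q) set \<Rightarrow> nat set \<Rightarrow> (nat \<Rightarrow> 'q) \<Rightarrow> (nat \<Rightarrow> 'q) set" where
  "matching_queries \<Q> \<T> q\<^sub>T = {q \<in> \<Q>. restrict q \<T> = q\<^sub>T}"

definition matching_queries_for ::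
    "(nat \<times> 'f \<Rightarrow> nat \<Rightarrow> 'q) \<Rightarrow> 'f set \<Rightarrow> nat \<Rightarrow> nat set \<Rightarrow> (nat \<Rightarrow> 'q) \<Rightarrow> (nat \<Rightarrow> 'q) set" where
  "matching_queries_for \<psi> \<F> m \<T> q\<^sub>T = {\<psi> (m, f) | f. f \<in> \<F> \<and> restrict (\<psi> (m, f)) \<T> = q\<^sub>T}"

end

theory Submission
  imports Defs
begin

text \<open>By bijectivity of \<open>\<psi>\<close>, the event that \<open>\<theta> = m\<close> and the queries seen by \<open>\<T>\<close> equal \<open>q\<^sub>T\<close>
  is the event that the whole query lies in \<open>matching_queries_for \<psi> \<F> m \<T> q\<^sub>T\<close>. As the query is
  uniform, the conditional probability given \<open>\<theta> = m\<close> is \<open>M / card \<Q>\<close> times the size of this set.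
  These sets partition \<open>matching_queries \<Q> \<T> q\<^sub>T\<close> as \<open>m\<close> varies, so they all have the same size
  iff each has a fraction \<open>1 / M\<close> of the total.\<close>

lemma uniform_rv_in_range:
  assumes "uniform_rv P X A" "\<omega> \<in> space P"
  shows "X \<omega> \<in> A"
  using assms measurable_space[of X P "count_space A" \<omega>] by (auto simp: uniform_rv_def)

text \<open>The probability is the mass of \<open>B\<close> under the law of \<open>X\<close>, which
  is the uniform counting measure. The premise \<open>B \<subseteq> A\<close> is what makes
  \<open>B\<close> measurable in \<open>count_space A\<close>.\<close>

lemma prob_uniform_rv:
  assumes X: "uniform_rv P X A" and "finite A" "B \<subseteq> A"
  shows "\<P>(\<omega> in P. X \<omega> \<in> B) = card B / card A"
proof -
  have "{\<omega> \<in> space P. X \<omega> \<in> B} = X -` B \<inter> space P"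
    by auto
  moreover have "measure P (X -` B \<inter> space P) = measure (distr P (count_space A) X) B"
    using X \<open>B \<subseteq> A\<close> by (subst measure_distr) (auto simp: uniform_rv_def)
  ultimately show ?thesis
    using X assms(2,3) by (simp add: uniform_rv_def measure_uniform_count_measure)
qed

context pir_query_scheme
begin

lemma finite_queries: "finite \<Q>"
  using bij_betw_finite[OF bij_psi] finite_keys by simp

lemma matching_queries_for_subset:
  "m \<in> {1..M} \<Longrightarrow> matching_queries_for \<psi> \<F> m \<T> q \<subseteq> \<Q>"
  using bij_betwE[OF bij_psi] by (auto simp: matching_queries_for_def)

text \<open>Injectivity of \<open>\<psi>\<close> lets the index be read off the full query tuple.
  The equivalence holds at every sample point, since \<open>uniform_rv\<close> confines the index
  and the key to their ranges everywhere and not just almost surely.\<close>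

lemma user_query_in_matching_queries_for_iff:
  assumes m: "m \<in> {1..M}" and \<omega>: "\<omega> \<in> space P"
  shows "user_query \<psi> \<theta> F \<omega> \<in> matching_queries_for \<psi> \<F> m \<T> q \<longleftrightarrow>
    restrict (user_query \<psi> \<theta> F \<omega>) \<T> = q \<and> \<theta> \<omega> = m"
proof -
  have "\<theta> \<omega> \<in> {1..M}" "F \<omega> \<in> \<F>"
    using uniform_rv_in_range[OF index_uniform \<omega>] uniform_rv_in_range[OF key_uniform \<omega>] by simp_all
  then have "\<psi> (\<theta> \<omega>, F \<omega>) = \<psi> (m, f) \<longleftrightarrow> \<theta> \<omega> = m \<and> F \<omega> = f" if "f \<in> \<F>" for f
    using inj_on_eq_iff[OF bij_betw_imp_inj_on[OF bij_psi], of "(\<theta> \<omega>, F \<omega>)" "(m, f)"] that m by simp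
  then show ?thesis
    using \<open>F \<omega> \<in> \<F>\<close> by (auto simp: matching_queries_for_def user_query_def)
qed

lemma cond_prob_matching:
  assumes m: "m \<in> {1..M}"
  shows "\<P>(\<omega> in P. restrict (user_query \<psi> \<theta> F \<omega>) \<T> = q \<bar> \<theta> \<omega> = m) =
    M * card (matching_queries_for \<psi> \<F> m \<T> q) / card \<Q>"
proof -
  \<comment> \<open>The two events agree as sets, so no almost-sure argument is needed.\<close>
  have "\<P>(\<omega> in P. restrict (user_query \<psi> \<theta> F \<omega>) \<T> = q \<and> \<theta> \<omega> = m) =
      \<P>(\<omega> in P. user_query \<psi> \<theta> F \<omega> \<in> matching_queries_for \<psi> \<F> m \<T> q)"
    by (intro arg_cong[of _ _ "measure P"] Collect_cong conj_cong refl)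
      (simp add: user_query_in_matching_queries_for_iff[OF m])
  also have "\<dots> = card (matching_queries_for \<psi> \<F> m \<T> q) / card \<Q>"
    using query_uniform finite_queries matching_queries_for_subset[OF m] by (rule prob_uniform_rv)
  \<comment> \<open>The event \<open>\<theta> \<omega> = m\<close> has probability
    \<open>1 / M\<close>; dividing by it produces the factor \<open>M\<close>.\<close>
  finally show ?thesis
    using prob_uniform_rv[OF index_uniform, of "{m}"] m by (simp add: cond_prob_def)
qed

text \<open>Surjectivity of \<open>\<psi>\<close> onto \<open>\<Q>\<close> makes the sets for the
  single indices cover all matching queries; injectivity makes them disjoint, so cardinalities
  add.\<close>

lemma card_matching_queries:
  "card (matching_queries \<Q> \<T> q) = (\<Sum>m\<in>{1..M}. card (matching_queries_for \<psi> \<F> m \<T> q))"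
proof -
  have "matching_queries \<Q> \<T> q = (\<Union>m\<in>{1..M}. matching_queries_for \<psi> \<F> m \<T> q)"
    unfolding matching_queries_def matching_queries_for_def bij_betw_imp_surj_on[OF bij_psi, symmetric]
    by fastforce
  moreover have "matching_queries_for \<psi> \<F> m \<T> q \<inter> matching_queries_for \<psi> \<F> m' \<T> q = {}"
    if "m \<in> {1..M}" "m' \<in> {1..M}" "m \<noteq> m'" for m m'
  proof -
    have "\<psi> (m, f) \<noteq> \<psi> (m', f')" if "f \<in> \<F>" "f' \<in> \<F>" for f f'
      using inj_on_eq_iff[OF bij_betw_imp_inj_on[OF bij_psi], of "(m, f)" "(m', f')"] that
        \<open>m \<in> {1..M}\<close> \<open>m' \<in> {1..M}\<close> \<open>m \<noteq> m'\<close> by simp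
    then show ?thesis
      unfolding matching_queries_for_def by blast
  qed
  moreover have "finite (matching_queries_for \<psi> \<F> m \<T> q)" if "m \<in> {1..M}" for m
    using finite_subset[OF matching_queries_for_subset[OF that] finite_queries] .
  ultimately show ?thesis
    by (simp add: card_UN_disjoint)
qed

end

theorem theorem2:
  fixes P :: "'w measure"
    and M S T :: nat
    and \<F> :: "'f set"
    and \<Q> :: "(nat \<Rightarrow> 'q) set"
    and \<psi> :: "nat \<times> 'f \<Rightarrow> nat \<Rightarrow> 'q"
    and \<theta> :: "'w \<Rightarrow> nat"
    and F :: "'w \<Rightarrow> 'f"
    and b :: real
    and \<T> :: "nat set"
    and q\<^sub>T :: "nat \<Rightarrow> 'q"
  assumes scheme: "pir_query_scheme P M S \<F> \<Q> \<psi> \<theta> F"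
    and base: "1 < b"
    and entropy_eq: "\<forall>m\<in>{1..M}. \<forall>m'\<in>{1..M}.
      entropy_given b P \<Q> (user_query \<psi> \<theta> F) \<theta> m = entropy_given b P \<Q> (user_query \<psi> \<theta> F) \<theta> m'"
    and colluding: "\<T> \<subseteq> {1..S}" "card \<T> = T"
    and possible: "q\<^sub>T \<in> (\<lambda>q. restrict q \<T>) ` \<Q>"
  shows "(\<forall>m\<in>{1..M}. \<forall>m'\<in>{1..M}.
            \<P>(\<omega> in P. restrict (user_query \<psi> \<theta> F \<omega>) \<T> = q\<^sub>T \<bar> \<theta> \<omega> = m)
          = \<P>(\<omega> in P. restrict (user_query \<psi> \<theta> F \<omega>) \<T> = q\<^sub>T \<bar> \<theta> \<omega> = m'))
     \<longleftrightarrow> (\<forall>m\<in>{1..M}.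
            card (matching_queries \<Q> \<T> q\<^sub>T) = M * card (matching_queries_for \<psi> \<F> m \<T> q\<^sub>T))"
proof -
  interpret pir_query_scheme P M S \<F> \<Q> \<psi> \<theta> F
    by (rule scheme)
  let ?c = "\<lambda>m. card (matching_queries_for \<psi> \<F> m \<T> q\<^sub>T)"
  \<comment> \<open>A possible value \<open>q\<^sub>T\<close> is the restriction of some tuple in
    \<open>\<Q>\<close>, so \<open>\<Q>\<close> is nonempty and the common factor
    \<open>M / card \<Q>\<close> can be cancelled below.\<close>
  have pos: "0 < M" "0 < card \<Q>"
    using M_ge_2 finite_queries possible by (auto simp: card_gt_0_iff)
  have "(\<forall>m\<in>{1..M}. \<forall>m'\<in>{1..M}.
            \<P>(\<omega> in P. restrict (user_query \<psi> \<theta> F \<omega>) \<T> = q\<^sub>T \<bar> \<theta> \<omega> = m)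
          = \<P>(\<omega> in P. restrict (user_query \<psi> \<theta> F \<omega>) \<T> = q\<^sub>T \<bar> \<theta> \<omega> = m'))
      \<longleftrightarrow> (\<forall>m\<in>{1..M}. \<forall>m'\<in>{1..M}. ?c m = ?c m')"
    using pos by (intro ball_cong refl) (simp add: cond_prob_matching)
  also have "\<dots> \<longleftrightarrow> (\<forall>m\<in>{1..M}. (\<Sum>k\<in>{1..M}. ?c k) = M * ?c m)"
  proof (intro iffI ballI)
    fix m assume "\<forall>m\<in>{1..M}. \<forall>m'\<in>{1..M}. ?c m = ?c m'" "m \<in> {1..M}"
    then have "(\<Sum>k\<in>{1..M}. ?c k) = (\<Sum>k\<in>{1..M}. ?c m)"
      by (intro sum.cong refl) blast
    then show "(\<Sum>k\<in>{1..M}. ?c k) = M * ?c m"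
      by simp
  next
    fix m m' assume *: "\<forall>m\<in>{1..M}. (\<Sum>k\<in>{1..M}. ?c k) = M * ?c m"
      and "m \<in> {1..M}" "m' \<in> {1..M}"
    \<comment> \<open>Both sides equal the same total over all indices.\<close>
    then have "M * ?c m = M * ?c m'"
      by metis
    then show "?c m = ?c m'"
      using pos by simp
  qed
  finally show ?thesis
    by (simp only: card_matching_queries)
qed

end
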